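(* Let $f_i(x)=\frac12 x^TP_ix-q_i^Tx+r_i$, $i=1,\dots,m$, be quadratic functions on $\mathbb{R}^n$, where each $P_i$ is a symmetric $n\times n$ real matrix, $q_i\in\mathbb{R}^n$ and $r_i\in\mathbb{R}$. Suppose that $f=\sum_{i=1}^m f_i$ is strongly convex with constant $c>0$, i.e. $f(x)-\frac c2\|x\|^2$ is convex on $\mathbb{R}^n$. Let $x^*$ be the unique minimizer of $f$ and $P=\sum_{i=1}^mP_i$. Consider the iterates $\{x_1^k\}$ generated by the incremental gradient (IG) method with stepsize $\alpha_k=R/k^s$, where $R>0$ and $s\in[0,1]$, and let $\mathrm{dist}_k=\|x_1^k-x^*\|$. Then: (i) If $s=1$, then $$\limsup_{k\to\infty} k\,\mathrm{dist}_k\le\frac{R^2M}{Rc-1}\quad\text{for } R>1/c,$$ $$\limsup_{k\to\infty}\frac{k}{\log k}\,\mathrm{dist}_k<\infty\quad\text{for } R=1/c,$$ $$\limsup_{k\to\infty}k^{Rc}\,\mathrm{dist}_k<\infty\quad\text{for } R<1/c,$$ where $M=\lim_{k\to\infty}\|E(\alpha_k)\|=\big\|\sum_{1\le i<j\le m}P_j\nabla f_i(x^* )\big\|$. (ii) If $0<s<1$, then, with $M=\big\|\sum_{1\le i<j\le m}P_j\nabla f_i(x^* )\big\|$ as in (i), $$\limsup_{k\to\infty}k^s\,\mathrm{dist}_k\le\frac{RM}{c}.$$ (iii) If $s=0$ and $R\le\frac1{\|P\|}$, then $$\mathrm{dist}_{k+1}\le(1-c\alpha)^k\,\mathrm{dist}_1+\frac{\alpha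 M_\infty}{c}\qquad\text{for all } k\ge1,$$ where the stepsize $\alpha=\alpha_k=R$ is constant and $M_\infty=\sup_{k\ge1}\|E(\alpha_k)\|$.
   Context: The IG method for minimizing $f=\sum_{i=1}^mf_i$ with stepsizes $\alpha_k>0$: from an initial point $x_1^1\in\mathbb{R}^n$, for each $k\ge1$ set $x_{i+1}^k=x_i^k-\alpha_k\nabla f_i(x_i^k)$ for $i=1,\dots,m$, and $x_1^{k+1}=x_{m+1}^k$. The points $x_1^k$ are the outer iterates. The norm $\|\cdot\|$ is the Euclidean norm for vectors and the spectral norm for matrices. The vector $E(\alpha_k)\in\mathbb{R}^n$ is the remainder in the outer iteration, defined by $$x_1^{k+1}=(I_n-\alpha_kP)x_1^k+\alpha_k\sum_{i=1}^mq_i+\alpha_k^2E(\alpha_k),$$ where $I_n$ is the identity matrix. The supremum $M_\infty$ is taken in $[0,\infty]$ (the bound in (iii) is trivial if it is infinite). *)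

theory Defs
  imports "HOL-Analysis.Analysis"
begin

definition gradient :: "('a::real_inner \<Rightarrow> real) \<Rightarrow> 'a \<Rightarrow> 'a" where
  "gradient f x = (THE D. GDERIV f x :> D)"

definition quadratic ::
  "real ^ 'n ^ 'n \<Rightarrow> real ^ 'n \<Rightarrow> real \<Rightarrow> real ^ 'n \<Rightarrow> real" where
  "quadratic P q r x = 1 / 2 * (x \<bullet> (P *v x)) - q \<bullet> x + r"

definition strongly_convex :: "real \<Rightarrow> ('a::real_inner \<Rightarrow> real) \<Rightarrow> bool" where
  "strongly_convex c f \<longleftrightarrow> c > 0 \<and> convex_on UNIV (\<lambda>x. f x - c / 2 * (norm x)\<^sup>2)"

definition the_minimizer :: "('a \<Rightarrow> real) \<Rightarrow> 'a" where
  "the_minimizer f = (THE x. is_arg_min f (\<lambda>_. True) x)"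

(* x k i is the inner iterate x_i^k, so x k 1 is the k-th outer iterate. Cycles k, component
   functions and inner iterates are all numbered from 1; values of f, alpha and x at other
   indices are irrelevant, and the initial point x 1 1 is arbitrary. *)
definition ig_iterates ::
  "nat \<Rightarrow> (nat \<Rightarrow> 'a::real_inner \<Rightarrow> real) \<Rightarrow> (nat \<Rightarrow> real) \<Rightarrow> (nat \<Rightarrow> nat \<Rightarrow> 'a) \<Rightarrow> bool" where
  "ig_iterates m f \<alpha> x \<longleftrightarrow>
     (\<forall>k\<ge>1. \<forall>i\<in>{1..m}. x k (i + 1) = x k i - \<alpha> k *\<^sub>R gradient (f i) (x k i)) \<and>
     (\<forall>k\<ge>1. x (k + 1) 1 = x k (m + 1))"

(* E k is the vector E(alpha_k); the equation determines it for k >= 1 since alpha_k is nonzero. *)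
definition ig_remainder ::
  "real ^ 'n ^ 'n \<Rightarrow> real ^ 'n \<Rightarrow> (nat \<Rightarrow> real) \<Rightarrow> (nat \<Rightarrow> nat \<Rightarrow> real ^ 'n) \<Rightarrow>
     (nat \<Rightarrow> real ^ 'n) \<Rightarrow> bool" where
  "ig_remainder P q \<alpha> x E \<longleftrightarrow>
     (\<forall>k\<ge>1. x (k + 1) 1 = (mat 1 - \<alpha> k *\<^sub>R P) *v x k 1 + \<alpha> k *\<^sub>R q + (\<alpha> k)\<^sup>2 *\<^sub>R E k)"

end

theory Submission
  imports Defs "HOL-Real_Asymp.Real_Asymp"
begin

text \<open>Write $d_k$ for the distance of the outer iterate $x_1^k$ to the minimizer. Since the minimizer
  solves $P x^* = \sum_i q_i$, the outer iteration reads
  $x_1^{k+1} - x^* = (I - \alpha_k P)(x_1^k - x^*) + \alpha_k^2 E_k$. As soon as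
  $\alpha_k \|P\| \le 1$, the symmetric matrix $I - \alpha_k P$ is positive semidefinite, and strong
  convexity bounds its quadratic form by $1 - c\alpha_k$; hence its norm is at most $1 - c \alpha_k$
  (\<open>selfadjoint_norm_le\<close>, \<open>gradient_step_contraction\<close>) and
  \[ d_{k+1} \le (1 - c\alpha_k) d_k + \alpha_k^2 \|E_k\|. \]
  For a constant stepsize this is a geometric series, which is the third part.

  For vanishing stepsizes one has to control $E_k$. Unrolling one cycle gives
  $E_k = \sum_{i<j} P_j \nabla f_i(x_i^k)$ (\<open>cycle_remainder_formula\<close>), so $\|E_k\|$ grows at most
  linearly in $d_k$. The noise $\alpha_k^2 \|E_k\|$ thus splits into a
  multiple of $\alpha_k^2 d_k$, which is negligible against the contraction $c \alpha_k d_k$, and a term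
  $O(\alpha_k^2)$; as $\sum_k \alpha_k$ diverges, $d_k \to 0$. Then all inner iterates of a cycle converge to $x^*$ as well, and by continuity $\|E_k\|$ tends
  to $M$.

  What is left is a scalar recursion with noise $R^2 \|E_k\| / k^{2s}$. Multiplying it by $k^s$
  produces a relaxation $u_{k+1} \le (1 - a_k) u_k + b_k$ in which $b_k / a_k$ tends to $R^2 M / L$,
  where $L = cR$ for $s < 1$, and $L = cR - 1$ for $s = 1$ because the growth of the factor $k$ then costs
  as much as the contraction gains; such a relaxation drives $u_k$ below the limiting ratio
  (\<open>relaxation_eventually_less\<close>, \<open>chung_limsup\<close>). If $s = 1$ and $cR \le 1$ this argument
  breaks down; there the distances are compared with explicit supersolutions of the recursion
  (\<open>supersolution_bound\<close>) that decay like $(\ln k)/k$ and like $k^{-cR}$.\<close>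

section \<open>Scalar recursions\<close>

lemma limsup_le_realI:
  fixes u :: "nat \<Rightarrow> real"
  assumes "\<And>B'. B < B' \<Longrightarrow> eventually (\<lambda>k. u k < B') sequentially"
  shows "limsup (\<lambda>k. ereal (u k)) \<le> ereal B"
  unfolding Limsup_le_iff
proof (intro allI impI)
  fix y :: ereal assume "ereal B < y"
  then show "eventually (\<lambda>k. ereal (u k) < y) sequentially"
    using assms by (cases y) auto
qed

lemma limsup_less_PInfI:
  fixes u :: "nat \<Rightarrow> real"
  assumes "eventually (\<lambda>k. u k \<le> C) sequentially"
  shows "limsup (\<lambda>k. ereal (u k)) < \<infinity>"
proof -
  have "limsup (\<lambda>k. ereal (u k)) \<le> ereal C"
    by (rule Limsup_bounded) (use assms in simp)
  then show ?thesis using le_less_trans by fastforce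
qed

text \<open>The sequence decreases to some limit $l \ge 0$. Its decrements telescope, so they are summable,
  and they dominate $l a_k$; with $a$ not summable this leaves only $l = 0$.\<close>

lemma relaxation_tendsto_zero:
  fixes p a :: "nat \<Rightarrow> real"
  assumes p: "\<And>k. p k \<ge> 0" and a: "\<And>k. a k \<ge> 0" and "\<not> summable a"
    and rec: "\<And>k. p (Suc k) \<le> (1 - a k) * p k"
  shows "p \<longlonglongrightarrow> 0"
proof -
  have "p (Suc k) \<le> p k" for k
  proof -
    have "a k * p k \<ge> 0" using a p by simp
    then show ?thesis using rec[of k] by (simp add: algebra_simps)
  qed
  then have dec: "decseq p" by (rule decseq_SucI)
  then obtain l where l: "p \<longlonglongrightarrow> l" and lp: "\<And>k. l \<le> p k"
    using decseq_convergent[of p 0] p by blast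
  have "l \<ge> 0" using LIMSEQ_le_const[OF l] p by blast
  moreover have "\<not> l > 0"
  proof
    assume "l > 0"
    have "summable (\<lambda>k. p k - p (Suc k))"
      using telescope_summable'[OF l] by simp
    moreover have "norm (l * a k) \<le> p k - p (Suc k)" for k
    proof -
      have "l * a k \<le> p k * a k" using a lp by (simp add: mult_right_mono)
      then show ?thesis using rec[of k] a[of k] \<open>l > 0\<close> by (simp add: algebra_simps)
    qed
    ultimately have "summable (\<lambda>k. l * a k)" by (blast intro: summable_comparison_test')
    then show False using \<open>l > 0\<close> \<open>\<not> summable a\<close> by (simp add: summable_cmult_iff)
  qed
  ultimately show ?thesis using l by simp
qed

text \<open>One step moves \<open>u k\<close> the fraction \<open>a k\<close> of the way towards \<open>b k / a k\<close>. Once these targets lie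
  below $B_1 \in (B, B')$, the excess of \<open>u\<close> over $B_1$ is contracted by \<open>1 - a k\<close> in each step, and it
  vanishes since the $a_k$ sum to infinity.\<close>

lemma relaxation_eventually_less:
  fixes u a b :: "nat \<Rightarrow> real"
  assumes rec: "eventually (\<lambda>k. u (Suc k) \<le> (1 - a k) * u k + b k) sequentially"
    and a: "eventually (\<lambda>k. 0 < a k \<and> a k \<le> 1) sequentially"
    and ns: "\<not> summable a"
    and ratio: "(\<lambda>k. b k / a k) \<longlonglongrightarrow> B"
    and "B < B'"
  shows "eventually (\<lambda>k. u k < B') sequentially"
proof -
  obtain B1 where B1: "B < B1" "B1 < B'" using \<open>B < B'\<close> dense by blast
  have "eventually (\<lambda>k. b k / a k < B1) sequentially"
    using ratio B1(1) by (rule order_tendstoD)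
  with rec a have "eventually (\<lambda>k. 0 < a k \<and> a k \<le> 1 \<and> b k / a k < B1
      \<and> u (Suc k) \<le> (1 - a k) * u k + b k) sequentially"
    by eventually_elim simp
  then obtain N where N: "\<And>k. k \<ge> N \<Longrightarrow> 0 < a k \<and> a k \<le> 1 \<and> b k / a k < B1
      \<and> u (Suc k) \<le> (1 - a k) * u k + b k"
    unfolding eventually_sequentially by blast
  define p where "p k = max 0 (u (k + N) - B1)" for k
  have "p \<longlonglongrightarrow> 0"
  proof (rule relaxation_tendsto_zero[where a = "\<lambda>k. a (k + N)"])
    show "\<not> summable (\<lambda>k. a (k + N))" using ns summable_iff_shift by blast
    show "p (Suc k) \<le> (1 - a (k + N)) * p k" for k
    proof -
      have *: "0 < a (k + N)" "a (k + N) \<le> 1" "b (k + N) / a (k + N) < B1"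
        "u (Suc (k + N)) \<le> (1 - a (k + N)) * u (k + N) + b (k + N)"
        using N[of "k + N"] by auto
      have "b (k + N) \<le> B1 * a (k + N)" using *(1,3) by (simp add: field_simps)
      with *(4) have "u (Suc (k + N)) - B1 \<le> (1 - a (k + N)) * (u (k + N) - B1)"
        by (simp add: algebra_simps)
      also have "\<dots> \<le> (1 - a (k + N)) * p k"
        using * by (intro mult_left_mono) (auto simp: p_def)
      finally show ?thesis using * by (auto simp: p_def)
    qed
  qed (use N in \<open>auto simp: p_def less_imp_le\<close>)
  then have "eventually (\<lambda>k. p k < B' - B1) sequentially"
    using B1(2) by (intro order_tendstoD) auto
  then have "eventually (\<lambda>k. u (k + N) < B') sequentially"
    by eventually_elim (auto simp: p_def)
  then show ?thesis using eventually_sequentially_seg by blast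
qed

text \<open>For $s \le 1$ such a sequence eventually dominates a multiple of the harmonic series.\<close>

lemma not_summable_of_powr_rate:
  fixes a :: "nat \<Rightarrow> real"
  assumes "s \<le> 1" "0 < L" and lim: "(\<lambda>k. a k * real k powr s) \<longlonglongrightarrow> L"
  shows "\<not> summable a"
proof
  assume "summable a"
  have "eventually (\<lambda>k. a k * real k powr s > L / 2) sequentially"
    using lim \<open>0 < L\<close> by (intro order_tendstoD) auto
  then have "eventually (\<lambda>k. norm (inverse (real k)) \<le> 2 / L * a k) sequentially"
    using eventually_ge_at_top[of 1]
  proof eventually_elim
    case (elim k)
    have "L / 2 < a k * real k powr s" by fact
    moreover have "0 < real k powr s" using elim(2) by simp
    ultimately have "a k > 0" using \<open>0 < L\<close>
      by (metis half_gt_zero less_trans zero_less_mult_pos2)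
    moreover have "real k powr s \<le> real k powr 1"
      using elim(2) assms(1) by (intro powr_mono) auto
    ultimately have "a k * real k powr s \<le> a k * real k" by simp
    then have "L / 2 < a k * real k" using elim(1) by linarith
    then show ?case using elim(2) \<open>0 < L\<close> by (simp add: field_simps)
  qed
  then have "summable (\<lambda>k. inverse (real k))"
    by (rule summable_comparison_test_ev) (intro summable_mult \<open>summable a\<close>)
  then show False using not_summable_harmonic[where 'a = real] by (simp add: inverse_eq_divide)
qed

text \<open>The relaxation principle in the form used for stepsizes of order $k^{-s}$: only the leading
  coefficients \<open>L\<close> and \<open>\<beta>\<close> of \<open>a\<close> and \<open>b\<close> matter.\<close>

lemma relaxation_powr_eventually_less:
  fixes u a b :: "nat \<Rightarrow> real"
  assumes rec: "eventually (\<lambda>k. u (Suc k) \<le> (1 - a k) * u k + b k) sequentially"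
    and s: "0 < s" "s \<le> 1" and L: "0 < L"
    and a: "(\<lambda>k. a k * real k powr s) \<longlonglongrightarrow> L"
    and b: "(\<lambda>k. b k * real k powr s) \<longlonglongrightarrow> \<beta>"
    and B': "\<beta> / L < B'"
  shows "eventually (\<lambda>k. u k < B') sequentially"
proof (rule relaxation_eventually_less[OF rec])
  have pos: "eventually (\<lambda>k. a k * real k powr s > 0) sequentially"
    using a L by (rule order_tendstoD)
  have inv: "(\<lambda>k. real k powr - s) \<longlonglongrightarrow> 0"
    using s by real_asymp
  have "(\<lambda>k. (a k * real k powr s) * real k powr - s) \<longlonglongrightarrow> L * 0"
    by (intro tendsto_mult a inv)
  then have "eventually (\<lambda>k. (a k * real k powr s) * real k powr - s < 1) sequentially"
    by (intro order_tendstoD) auto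
  with pos eventually_gt_at_top[of 0]
  show "eventually (\<lambda>k. 0 < a k \<and> a k \<le> 1) sequentially"
    by eventually_elim (auto simp: powr_minus zero_less_mult_iff field_simps)
  have "(\<lambda>k. (b k * real k powr s) / (a k * real k powr s)) \<longlonglongrightarrow> \<beta> / L"
    using L by (intro tendsto_divide a b) auto
  then show "(\<lambda>k. b k / a k) \<longlonglongrightarrow> \<beta> / L"
    by (rule Lim_transform_eventually)
       (use eventually_gt_at_top[of 0] in eventually_elim, simp)
  show "\<not> summable a" using s(2) L a by (rule not_summable_of_powr_rate)
qed fact

text \<open>A lemma of Chung. The rescaled sequence $u_k = k^s d_k$ satisfies a relaxation because
  $(k+1)^s \le (1 + 1/k) k^s$ for $s \le 1$. The factor $1 + 1/k$ weakens the contraction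
  $p / k^s$ by $1/k$, which is of lower order if $s < 1$ and of the same order if $s = 1$; this is
  where the case distinction in \<open>L\<close> comes from.\<close>

lemma chung_limsup:
  fixes d e :: "nat \<Rightarrow> real"
  assumes s: "0 < s" "s \<le> 1" and d: "\<And>k. d k \<ge> 0"
    and rec: "eventually (\<lambda>k. d (Suc k) \<le>
      (1 - p / real k powr s) * d k + e k / (real k powr s)\<^sup>2) sequentially"
    and e: "e \<longlonglongrightarrow> \<beta>"
    and L: "L = p - (if s = 1 then 1 else 0)" "0 < L"
  shows "limsup (\<lambda>k. ereal (real k powr s * d k)) \<le> ereal (\<beta> / L)"
proof (rule limsup_le_realI)
  fix B' assume B': "\<beta> / L < B'"
  define a where "a k = 1 - (1 + 1 / real k) * (1 - p / real k powr s)" for k :: nat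
  define b where "b k = (1 + 1 / real k) * (e k / real k powr s)" for k :: nat
  have inv: "(\<lambda>k. 1 / real k) \<longlonglongrightarrow> 0" by real_asymp
  show "eventually (\<lambda>k. real k powr s * d k < B') sequentially"
  proof (rule relaxation_powr_eventually_less[OF _ s L(2) _ _ B'])
    show "eventually (\<lambda>k. real (Suc k) powr s * d (Suc k) \<le>
        (1 - a k) * (real k powr s * d k) + b k) sequentially"
      using rec eventually_gt_at_top[of 0]
    proof eventually_elim
      case (elim k)
      define w where "w = real k powr s"
      have w: "w > 0" using elim(2) by (simp add: w_def)
      have "(1 + 1 / real k) powr s \<le> (1 + 1 / real k) powr 1"
        using s by (intro powr_mono) auto
      then have "(1 + 1 / real k) powr s * w \<le> (1 + 1 / real k) * w"
        using w by simp
      moreover have "real (Suc k) = (1 + 1 / real k) * real k"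
        using elim(2) by (simp add: field_simps)
      then have "real (Suc k) powr s = (1 + 1 / real k) powr s * w"
        by (simp add: powr_mult w_def)
      ultimately have "real (Suc k) powr s \<le> (1 + 1 / real k) * w" by simp
      then have "real (Suc k) powr s * d (Suc k) \<le> (1 + 1 / real k) * w * d (Suc k)"
        using d by (intro mult_right_mono)
      also have "\<dots> \<le> (1 + 1 / real k) * w * ((1 - p / w) * d k + e k / w\<^sup>2)"
        using elim(1) w by (intro mult_left_mono) (auto simp: w_def)
      also have "\<dots> = (1 - a k) * (w * d k) + b k"
        using w by (simp add: a_def b_def w_def[symmetric] power2_eq_square distrib_left)
      finally show ?case by (simp add: w_def)
    qed
    have lim1: "(\<lambda>k. real k powr (s - 1)) \<longlonglongrightarrow> (if s = 1 then 1 else 0)"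
    proof (cases "s = 1")
      case True
      have "(\<lambda>k. real k powr 0) \<longlonglongrightarrow> 1"
        by (rule tendsto_eventually) (use eventually_gt_at_top[of 0] in eventually_elim, simp)
      then show ?thesis using True by simp
    next
      case False
      then have "s - 1 < 0" using s by simp
      then show ?thesis using False tendsto_neg_powr[OF _ filterlim_real_sequentially] by simp
    qed
    have "(\<lambda>k. p + p * (1 / real k) - real k powr (s - 1)) \<longlonglongrightarrow>
        p + p * 0 - (if s = 1 then 1 else 0)"
      by (intro tendsto_intros inv lim1)
    then have "(\<lambda>k. p + p * (1 / real k) - real k powr (s - 1)) \<longlonglongrightarrow> L"
      using L by simp
    then show "(\<lambda>k. a k * real k powr s) \<longlonglongrightarrow> L"
      by (rule Lim_transform_eventually)
         (use eventually_gt_at_top[of 0] in eventually_elim,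
          simp add: a_def powr_diff field_simps)
    have "(\<lambda>k. (1 + 1 / real k) * e k) \<longlonglongrightarrow> (1 + 0) * \<beta>"
      by (intro tendsto_intros inv e)
    then have "(\<lambda>k. (1 + 1 / real k) * e k) \<longlonglongrightarrow> \<beta>" by simp
    then show "(\<lambda>k. b k * real k powr s) \<longlonglongrightarrow> \<beta>"
      by (rule Lim_transform_eventually)
         (use eventually_gt_at_top[of 0] in eventually_elim, simp add: b_def)
  qed
qed

text \<open>Since $b \ge 0$, every multiple $C \phi$ with $C \ge 1$ of a supersolution is again a supersolution,
  so it suffices to choose \<open>C\<close> large enough at one index from which all conditions hold.\<close>

lemma supersolution_bound:
  fixes d a b \<phi> :: "nat \<Rightarrow> real"
  assumes "eventually (\<lambda>k. 0 \<le> b k \<and> a k \<le> 1 \<and> 0 < \<phi> k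
      \<and> d (Suc k) \<le> (1 - a k) * d k + b k
      \<and> (1 - a k) * \<phi> k + b k \<le> \<phi> (Suc k)) sequentially"
  obtains C where "C \<ge> 1" "eventually (\<lambda>k. d k \<le> C * \<phi> k) sequentially"
proof -
  obtain N where N: "\<And>k. k \<ge> N \<Longrightarrow> 0 \<le> b k \<and> a k \<le> 1 \<and> 0 < \<phi> k
      \<and> d (Suc k) \<le> (1 - a k) * d k + b k \<and> (1 - a k) * \<phi> k + b k \<le> \<phi> (Suc k)"
    using assms unfolding eventually_sequentially by blast
  define C where "C = max 1 (d N / \<phi> N)"
  have C: "C \<ge> 1" by (simp add: C_def)
  have "d k \<le> C * \<phi> k" if "k \<ge> N" for k
    using that
  proof (induction k rule: dec_induct)
    case base
    have "d N / \<phi> N \<le> C" by (simp add: C_def)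
    then show ?case using N[of N] by (simp add: field_simps)
  next
    case (step k)
    note Nk = N[OF step.hyps(1)]
    have "d (Suc k) \<le> (1 - a k) * d k + b k" using Nk by simp
    also have "\<dots> \<le> (1 - a k) * (C * \<phi> k) + C * b k"
      using Nk C step.IH by (intro add_mono mult_left_mono) (auto simp: mult_le_cancel_right1)
    also have "\<dots> = C * ((1 - a k) * \<phi> k + b k)" by (simp add: algebra_simps)
    also have "\<dots> \<le> C * \<phi> (Suc k)" using Nk C by (intro mult_left_mono) auto
    finally show ?case .
  qed
  then have "eventually (\<lambda>k. d k \<le> C * \<phi> k) sequentially"
    unfolding eventually_sequentially by blast
  with C that show thesis by blast
qed

text \<open>For the coefficient $1 - 1/k$, multiplication of the recursion by $k$ turns it into
  $k d_{k+1} \le (k-1) d_k + K/k$, whose solution is a harmonic sum divided by $k - 1$. The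
  supersolution replaces that sum by a logarithm.\<close>

lemma harmonic_recursion_critical:
  fixes d :: "nat \<Rightarrow> real"
  assumes K: "K > 0"
    and rec: "eventually (\<lambda>k. d (Suc k) \<le> (1 - 1 / real k) * d k + K / (real k)\<^sup>2) sequentially"
  shows "limsup (\<lambda>k. ereal (real k / ln (real k) * d k)) < \<infinity>"
proof -
  define \<phi> where "\<phi> k = 2 * K * (ln (real k) / (real k - 1))" for k :: nat
  obtain C where C: "C \<ge> 1" "eventually (\<lambda>k. d k \<le> C * \<phi> k) sequentially"
  proof (rule supersolution_bound[of "\<lambda>k. K / (real k)\<^sup>2" "\<lambda>k. 1 / real k" \<phi> d])
    show "eventually (\<lambda>k. 0 \<le> K / (real k)\<^sup>2 \<and> 1 / real k \<le> 1 \<and> 0 < \<phi> k \<and>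
        d (Suc k) \<le> (1 - 1 / real k) * d k + K / (real k)\<^sup>2 \<and>
        (1 - 1 / real k) * \<phi> k + K / (real k)\<^sup>2 \<le> \<phi> (Suc k)) sequentially"
      using rec eventually_gt_at_top[of 1]
    proof eventually_elim
      case (elim k)
      \<comment> \<open>The logarithm gains at least $1/(2k)$ per step, which pays for the noise; this explains the
        factor 2 in \<open>\<phi>\<close>.\<close>
      have "ln (real k / real (Suc k)) \<le> real k / real (Suc k) - 1"
        using elim(2) by (intro ln_le_minus_one) auto
      then have "1 / real (Suc k) \<le> ln (real (Suc k)) - ln (real k)"
        using elim(2) by (simp add: ln_div field_simps)
      moreover have "1 / (2 * real k) \<le> 1 / real (Suc k)"
        using elim(2) by (intro divide_left_mono) auto
      ultimately have ln: "1 / (2 * real k) + ln (real k) \<le> ln (real (Suc k))" by linarith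
      have "(1 - 1 / real k) * \<phi> k + K / (real k)\<^sup>2
          = 2 * K / real k * (1 / (2 * real k) + ln (real k))"
        using elim(2) by (simp add: \<phi>_def power2_eq_square divide_simps) (simp add: algebra_simps)
      also have "\<dots> \<le> 2 * K / real k * ln (real (Suc k))"
        using ln K by (intro mult_left_mono) auto
      also have "\<dots> = \<phi> (Suc k)" by (simp add: \<phi>_def)
      finally show ?case using elim K by (simp add: \<phi>_def)
    qed
  qed
  have "eventually (\<lambda>k. real k / ln (real k) * d k \<le> 4 * C * K) sequentially"
    using C(2) eventually_gt_at_top[of 1]
  proof eventually_elim
    case (elim k)
    have k: "real k > 1" "ln (real k) > 0" using elim(2) by auto
    have "real k / ln (real k) * d k \<le> real k / ln (real k) * (C * \<phi> k)"
      using elim k by (intro mult_left_mono) auto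
    also have "\<dots> = 2 * C * K * (real k / (real k - 1))"
      using k by (simp add: \<phi>_def)
    also have "\<dots> \<le> 2 * C * K * 2"
      using elim(2) C K by (intro mult_left_mono) (auto simp: divide_simps)
    finally show ?case by simp
  qed
  then show ?thesis by (rule limsup_less_PInfI)
qed

text \<open>The function $k^{-p}$ is a supersolution of the recursion without noise, by
  $1 - p/k \le (1 + 1/k)^{-p}$. Subtracting a multiple of $1/k$, which decays faster because $p < 1$, creates a
  slack of order $1/k^2$ that absorbs the noise.\<close>

lemma harmonic_recursion_subcritical:
  fixes d :: "nat \<Rightarrow> real"
  assumes K: "K > 0" and p: "0 < p" "p < 1"
    and rec: "eventually (\<lambda>k. d (Suc k) \<le> (1 - p / real k) * d k + K / (real k)\<^sup>2) sequentially"
  shows "limsup (\<lambda>k. ereal (real k powr p * d k)) < \<infinity>"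
proof -
  define B where "B = 2 * K / (1 - p)"
  have B: "B > 0" using K p by (simp add: B_def)
  define \<phi> where "\<phi> k = 2 * B * real k powr - p - B / real k" for k :: nat
  obtain C where C: "C \<ge> 1" "eventually (\<lambda>k. d k \<le> C * \<phi> k) sequentially"
  proof (rule supersolution_bound[of "\<lambda>k. K / (real k)\<^sup>2" "\<lambda>k. p / real k" \<phi> d])
    have "(\<lambda>k. real k / real (Suc k)) \<longlonglongrightarrow> 1" by real_asymp
    then have "eventually (\<lambda>k. real k / real (Suc k) > (1 + p) / 2) sequentially"
      using p by (intro order_tendstoD) auto
    with rec eventually_gt_at_top[of 0]
    show "eventually (\<lambda>k. 0 \<le> K / (real k)\<^sup>2 \<and> p / real k \<le> 1 \<and> 0 < \<phi> k \<and>
        d (Suc k) \<le> (1 - p / real k) * d k + K / (real k)\<^sup>2 \<and>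
        (1 - p / real k) * \<phi> k + K / (real k)\<^sup>2 \<le> \<phi> (Suc k)) sequentially"
    proof eventually_elim
      case (elim k)
      have "1 / real k = real k powr - 1" by (simp add: powr_minus_divide)
      also have "\<dots> \<le> real k powr - p" using p elim(2) by (intro powr_mono) auto
      finally have "B * (1 / real k) \<le> B * real k powr - p" using B by (intro mult_left_mono) auto
      moreover have "0 < B * real k powr - p" using B elim(2) by simp
      ultimately have pos: "0 < \<phi> k" by (simp add: \<phi>_def)
      have "1 - p / real k \<le> (1 + 1 / real k) powr - p"
      proof -
        have "p * ln (1 + 1 / real k) \<le> p * (1 / real k)"
          using p by (intro mult_left_mono ln_add_one_self_le_self) auto
        moreover have "1 + - p * ln (1 + 1 / real k) \<le> exp (- p * ln (1 + 1 / real k))"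
          by (rule exp_ge_add_one_self)
        moreover have "1 + 1 / real k \<noteq> 0" by (simp add: add_nonneg_eq_0_iff)
        ultimately show ?thesis by (simp add: powr_def)
      qed
      then have "(1 - p / real k) * real k powr - p \<le> (1 + 1 / real k) powr - p * real k powr - p"
        by (intro mult_right_mono) auto
      also have "\<dots> = ((1 + 1 / real k) * real k) powr - p" by (simp add: powr_mult)
      also have "(1 + 1 / real k) * real k = real (Suc k)"
        using elim(2) by (simp add: field_simps)
      finally have 1: "2 * B * ((1 - p / real k) * real k powr - p) \<le> 2 * B * real (Suc k) powr - p"
        using B by (intro mult_left_mono) auto
      \<comment> \<open>The subtracted term leaves the slack $B (k/(k+1) - p) / k^2$; the limit of the bracket is
        $1 - p$, so half of that is available for large $k$, whence the choice of \<open>B\<close>.\<close>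
      have "K = B * ((1 + p) / 2 - p)" using p by (simp add: B_def field_simps)
      also have "\<dots> \<le> B * (real k / real (Suc k) - p)"
        using B elim(3) by (intro mult_left_mono) auto
      finally have "K / (real k)\<^sup>2 \<le> B * (real k / real (Suc k) - p) / (real k)\<^sup>2"
        by (intro divide_right_mono) auto
      also have "\<dots> = (1 - p / real k) * (B / real k) - B / real (Suc k)"
        using elim(2) by (simp add: power2_eq_square divide_simps) (simp add: algebra_simps)
      finally have "(1 - p / real k) * \<phi> k + K / (real k)\<^sup>2 \<le> \<phi> (Suc k)"
        using 1 by (simp add: \<phi>_def algebra_simps)
      moreover have "p / real k \<le> 1" using p elim(2) by (simp add: field_simps)
      ultimately show ?case using elim K pos by simp
    qed
  qed
  have "eventually (\<lambda>k. real k powr p * d k \<le> 2 * C * B) sequentially"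
    using C(2) eventually_gt_at_top[of 0]
  proof eventually_elim
    case (elim k)
    have "d k \<le> C * (2 * B * real k powr - p)"
      using elim(1) C(1) B by (rule_tac order_trans[OF elim(1)], intro mult_left_mono)
        (auto simp: \<phi>_def)
    then have "real k powr p * d k \<le> real k powr p * (C * (2 * B * real k powr - p))"
      by (intro mult_left_mono) auto
    also have "\<dots> = 2 * C * B" using elim(2) by (simp add: powr_minus)
    finally show ?case .
  qed
  then show ?thesis by (rule limsup_less_PInfI)
qed


section \<open>Quadratic functions\<close>

text \<open>The norm of a positive self-adjoint operator is the supremum of its quadratic form. This is the
  Cauchy-Schwarz inequality for the semidefinite form $v \bullet T w$ applied to $v$ and $T v$, obtained by
  evaluating the form at $v - t\,T v$ with the optimal $t = 1/\beta$.\<close>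

lemma selfadjoint_norm_le:
  fixes T :: "'a::real_inner \<Rightarrow> 'a"
  assumes T: "linear T" and sa: "\<And>v w. v \<bullet> T w = T v \<bullet> w"
    and pos: "\<And>v. 0 \<le> v \<bullet> T v" and le: "\<And>v. v \<bullet> T v \<le> \<beta> * (norm v)\<^sup>2"
    and "\<beta> \<ge> 0"
  shows "norm (T v) \<le> \<beta> * norm v"
proof -
  have main: "0 \<le> \<beta> * (norm v)\<^sup>2 - 2 * t * (norm (T v))\<^sup>2 + t\<^sup>2 * (\<beta> * (norm (T v))\<^sup>2)" for t
  proof -
    have "0 \<le> (v - t *\<^sub>R T v) \<bullet> T (v - t *\<^sub>R T v)" by (rule pos)
    also have "\<dots> = v \<bullet> T v - 2 * t * (norm (T v))\<^sup>2 + t\<^sup>2 * (T v \<bullet> T (T v))"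
      using sa[of v "T v"]
      unfolding power2_norm_eq_inner
      by (simp add: linear_diff[OF T] linear_scale[OF T] inner_diff_left inner_diff_right
          power2_eq_square algebra_simps)
    also have "\<dots> \<le> \<beta> * (norm v)\<^sup>2 - 2 * t * (norm (T v))\<^sup>2 + t\<^sup>2 * (\<beta> * (norm (T v))\<^sup>2)"
      using le[of v] mult_left_mono[OF le[of "T v"], of "t\<^sup>2"] by simp
    finally show ?thesis .
  qed
  show ?thesis
  proof (cases "\<beta> = 0")
    case True
    \<comment> \<open>Here the form vanishes identically and any positive \<open>t\<close> will do.\<close>
    then have "(norm (T v))\<^sup>2 \<le> 0" using main[of 1] by simp
    then show ?thesis using True by simp
  next
    case False
    then have "\<beta> > 0" using \<open>\<beta> \<ge> 0\<close> by simp
    then have "(norm (T v))\<^sup>2 \<le> (\<beta> * norm v)\<^sup>2"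
      using main[of "1 / \<beta>"] by (simp add: power2_eq_square field_simps)
    then show ?thesis by (rule power2_le_imp_le) (use \<open>\<beta> > 0\<close> in simp)
  qed
qed

lemma symmetric_matrix_inner:
  fixes A :: "real ^ 'n ^ 'n"
  assumes "transpose A = A"
  shows "v \<bullet> (A *v w) = (A *v v) \<bullet> w"
  using dot_lmul_matrix[of v A w] assms by (metis transpose_matrix_vector)

lemma gradient_quadratic:
  fixes A :: "real ^ 'n ^ 'n"
  assumes "transpose A = A"
  shows "gradient (quadratic A b r) x = A *v x - b"
proof -
  have bl: "bounded_linear ((*v) A)" by (rule matrix_vector_mul_bounded_linear)
  have "(quadratic A b r has_derivative (\<lambda>h. 1 / 2 * (x \<bullet> (A *v h) + h \<bullet> (A *v x)) - b \<bullet> h)) (at x)"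
    unfolding quadratic_def[abs_def]
    by (auto intro!: derivative_eq_intros bounded_linear.has_derivative[OF bl])
  also have "(\<lambda>h. 1 / 2 * (x \<bullet> (A *v h) + h \<bullet> (A *v x)) - b \<bullet> h) = (\<bullet>) (A *v x - b)"
  proof
    fix h
    have "x \<bullet> (A *v h) = (A *v x) \<bullet> h" by (rule symmetric_matrix_inner[OF assms])
    moreover have "h \<bullet> (A *v x) = (A *v x) \<bullet> h" by (rule inner_commute)
    ultimately show "1 / 2 * (x \<bullet> (A *v h) + h \<bullet> (A *v x)) - b \<bullet> h = (A *v x - b) \<bullet> h"
      by (simp add: inner_diff_left)
  qed
  finally have "GDERIV (quadratic A b r) x :> A *v x - b"
    by (simp add: gderiv_def inner_commute)
  moreover have "D = D'" if "GDERIV g x :> D" "GDERIV g x :> D'" for g and D D' :: "real ^ 'n"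
  proof -
    have "(\<lambda>h. h \<bullet> D) = (\<lambda>h. h \<bullet> D')"
      using that unfolding gderiv_def by (rule has_derivative_unique)
    then show ?thesis by (metis vector_eq_ldot)
  qed
  ultimately show ?thesis unfolding gradient_def by blast
qed

lemma sum_quadratic:
  "(\<Sum>i\<in>I. quadratic (A i) (b i) (r i) x) = quadratic (\<Sum>i\<in>I. A i) (\<Sum>i\<in>I. b i) (\<Sum>i\<in>I. r i) x"
proof (induction I rule: infinite_finite_induct)
  case (insert i I)
  then show ?case
    by (simp add: quadratic_def matrix_vector_mult_add_rdistrib inner_add_left inner_add_right
        algebra_simps)
qed (simp_all add: quadratic_def)

text \<open>Convexity of $f - \frac c2 \|\cdot\|^2$ at the midpoint $0$ of $v$ and $-v$ is enough: the linear
  terms cancel.\<close>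

lemma strongly_convex_quadratic_form:
  assumes "strongly_convex c (quadratic A b r)"
  shows "c * (norm v)\<^sup>2 \<le> v \<bullet> (A *v v)"
proof -
  define G where "G x = quadratic A b r x - c / 2 * (norm x)\<^sup>2" for x
  have conv: "convex_on UNIV G" using assms by (simp add: strongly_convex_def G_def[abs_def])
  have "G ((1 - 1 / 2) *\<^sub>R v + (1 / 2) *\<^sub>R (- v)) \<le> (1 - 1 / 2) * G v + 1 / 2 * G (- v)"
    by (rule convex_onD[OF conv]) auto
  moreover have "A *v (- v) = - (A *v v)"
    using matrix_vector_mult_scaleR[of A "-1" v] by simp
  ultimately show ?thesis by (simp add: G_def quadratic_def field_simps)
qed

text \<open>The quadratic form is definite, so \<open>A\<close> is invertible; completing the square at the solution \<open>z\<close> of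
  $A z = b$ shows that \<open>z\<close> is a strict minimizer, and thus the one that the description operator
  picks.\<close>

lemma quadratic_minimizer_solves:
  fixes A :: "real ^ 'n ^ 'n"
  assumes symA: "transpose A = A" and sc: "strongly_convex c (quadratic A b r)"
  shows "A *v the_minimizer (quadratic A b r) = b"
proof -
  have c: "c > 0" using sc by (simp add: strongly_convex_def)
  note form = strongly_convex_quadratic_form[OF sc]
  have "v = 0" if "A *v v = 0" for v
  proof -
    have "c * (norm v)\<^sup>2 \<le> 0" using form[of v] that by simp
    then show ?thesis using c by (simp add: mult_le_0_iff)
  qed
  then obtain B where "B ** A = mat 1" using matrix_left_invertible_ker by blast
  then have "A ** B = mat 1" by (simp add: matrix_left_right_inverse)
  then have z: "A *v (B *v b) = b" by (metis matrix_vector_mul_assoc matrix_vector_mul_lid)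
  define z where "z = B *v b"
  have Az: "A *v z = b" using z by (simp add: z_def)
  have expand: "quadratic A b r y = quadratic A b r z + 1 / 2 * ((y - z) \<bullet> (A *v (y - z)))" for y
    using symmetric_matrix_inner[OF symA, of y z] symmetric_matrix_inner[OF symA, of z y]
    by (simp add: quadratic_def Az matrix_vector_mult_diff_distrib inner_diff_left
        inner_diff_right inner_commute field_simps)
  have strict: "quadratic A b r z < quadratic A b r y" if "y \<noteq> z" for y
  proof -
    have "0 < c * (norm (y - z))\<^sup>2" using c that by simp
    then show ?thesis using form[of "y - z"] expand[of y] by simp
  qed
  have "the_minimizer (quadratic A b r) = z"
    unfolding the_minimizer_def is_arg_min_def
  proof (rule the_equality)
    show "True \<and> (\<nexists>y. True \<and> quadratic A b r y < quadratic A b r z)"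
      using strict by (metis less_asym)
  qed (use strict in blast)
  then show ?thesis using Az by simp
qed

text \<open>The bound on \<open>t\<close> makes $I - tA$ positive semidefinite, which is what allows its norm to be read
  off from the quadratic form.\<close>

lemma gradient_step_contraction:
  fixes A :: "real ^ 'n ^ 'n"
  assumes symA: "transpose A = A" and form: "\<And>v. c * (norm v)\<^sup>2 \<le> v \<bullet> (A *v v)"
    and t: "0 \<le> t" "t * onorm ((*v) A) \<le> 1"
  shows "norm ((mat 1 - t *\<^sub>R A) *v v) \<le> (1 - c * t) * norm v"
    and "c * t \<le> 1"
proof -
  have op: "(mat 1 - t *\<^sub>R A) *v w = w - t *\<^sub>R (A *v w)" for w
    by (simp add: matrix_vector_mult_diff_rdistrib scaleR_matrix_vector_assoc)
  have qf: "w \<bullet> ((mat 1 - t *\<^sub>R A) *v w) = (norm w)\<^sup>2 - t * (w \<bullet> (A *v w))" for w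
    by (simp only: op inner_diff_right inner_scaleR_right power2_norm_eq_inner)
  have pos: "0 \<le> w \<bullet> ((mat 1 - t *\<^sub>R A) *v w)" for w
  proof -
    have "w \<bullet> (A *v w) \<le> norm w * norm (A *v w)" by (rule norm_cauchy_schwarz)
    also have "\<dots> \<le> norm w * (onorm ((*v) A) * norm w)"
      by (intro mult_left_mono onorm matrix_vector_mul_bounded_linear) auto
    finally have "t * (w \<bullet> (A *v w)) \<le> t * (norm w * (onorm ((*v) A) * norm w))"
      using t by (intro mult_left_mono)
    also have "\<dots> = t * onorm ((*v) A) * (norm w)\<^sup>2" by (simp add: power2_eq_square)
    also have "\<dots> \<le> 1 * (norm w)\<^sup>2" using t by (intro mult_right_mono) auto
    finally show ?thesis by (simp add: qf)
  qed
  have le: "w \<bullet> ((mat 1 - t *\<^sub>R A) *v w) \<le> (1 - c * t) * (norm w)\<^sup>2" for w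
    using mult_left_mono[OF form[of w] t(1)]
    unfolding qf by (simp add: algebra_simps)
  \<comment> \<open>A unit vector shows that the upper bound of the form is nonnegative.\<close>
  have "0 \<le> (1 - c * t) * (norm (axis undefined 1 :: real ^ 'n))\<^sup>2"
    using pos le order_trans by blast
  then show ct: "c * t \<le> 1" by (simp add: norm_axis_1)
  show "norm ((mat 1 - t *\<^sub>R A) *v v) \<le> (1 - c * t) * norm v"
  proof (rule selfadjoint_norm_le[OF _ _ pos le])
    show "linear ((*v) (mat 1 - t *\<^sub>R A))" by (rule matrix_vector_mul_linear)
    show "v \<bullet> ((mat 1 - t *\<^sub>R A) *v w) = ((mat 1 - t *\<^sub>R A) *v v) \<bullet> w" for v w
      by (simp only: op inner_diff_left inner_diff_right inner_scaleR_left inner_scaleR_right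
          symmetric_matrix_inner[OF symA])
    show "0 \<le> 1 - c * t" using ct by simp
  qed
qed

section \<open>One cycle of the incremental gradient method\<close>

lemma sum_matrix_vector_mult:
  fixes A :: "'b \<Rightarrow> real ^ 'n ^ 'm"
  shows "(\<Sum>i\<in>I. A i) *v v = (\<Sum>i\<in>I. A i *v v)"
  by (induction I rule: infinite_finite_induct) (simp_all add: matrix_vector_mult_add_rdistrib)

text \<open>Within a cycle, $z_j = z_1 - t \sum_{i<j} g_i$ with $g_i$ the gradient used in step $i$. Evaluating
  all gradients at $z_1$ would give the exact gradient step, so $t^2 e$ is $t$ times the sum of the
  discrepancies $A_j (z_1 - z_j) = t \sum_{i<j} A_j g_i$.\<close>

lemma cycle_remainder_formula:
  fixes A :: "nat \<Rightarrow> real ^ 'n ^ 'n" and b z :: "nat \<Rightarrow> real ^ 'n"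
  assumes step: "\<And>i. i \<in> {1..m} \<Longrightarrow> z (i + 1) = z i - t *\<^sub>R (A i *v z i - b i)"
    and rem: "z (m + 1) = (mat 1 - t *\<^sub>R (\<Sum>i=1..m. A i)) *v z 1 + t *\<^sub>R (\<Sum>i=1..m. b i) + t\<^sup>2 *\<^sub>R e"
    and t: "t \<noteq> 0"
  shows "e = (\<Sum>(i, j) \<in> {(i, j). 1 \<le> i \<and> i < j \<and> j \<le> m}. A j *v (A i *v z i - b i))"
proof -
  define g where "g i = A i *v z i - b i" for i
  have partial: "z (Suc i) = z 1 - t *\<^sub>R (\<Sum>l=1..i. g l)" if "i \<le> m" for i
    using that
  proof (induction i)
    case (Suc i)
    have "z (Suc (Suc i)) = z (Suc i) - t *\<^sub>R g (Suc i)"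
      using step[of "Suc i"] Suc.prems by (simp add: g_def)
    then show ?case using Suc by (simp add: scaleR_add_right)
  qed simp
  have diff: "A j *v z 1 - A j *v z j = t *\<^sub>R (\<Sum>i\<in>{1..<j}. A j *v g i)" if "j \<in> {1..m}" for j
  proof -
    have "z j = z 1 - t *\<^sub>R (\<Sum>i\<in>{1..<j}. g i)"
      using partial[of "j - 1"] that
      by (cases j) (auto simp: atLeastLessThanSuc_atLeastAtMost)
    then have "z 1 - z j = t *\<^sub>R (\<Sum>i\<in>{1..<j}. g i)" by simp
    then show ?thesis
      unfolding matrix_vector_mult_diff_distrib[symmetric]
      by (simp only: matrix_vector_mult_scaleR linear_sum[OF matrix_vector_mul_linear])
  qed
  have "t *\<^sub>R (t *\<^sub>R e) = t\<^sup>2 *\<^sub>R e" by (simp add: power2_eq_square)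
  also have "\<dots> = t *\<^sub>R (\<Sum>j=1..m. A j *v z 1 - A j *v z j)"
  proof -
    have "(mat 1 - t *\<^sub>R (\<Sum>i=1..m. A i)) *v z 1 = z 1 - t *\<^sub>R (\<Sum>i=1..m. A i *v z 1)"
      by (simp add: matrix_vector_mult_diff_rdistrib scaleR_matrix_vector_assoc[symmetric]
          sum_matrix_vector_mult)
    then show ?thesis
      using rem partial[of m] by (simp add: g_def sum_subtractf algebra_simps)
  qed
  also have "(\<Sum>j=1..m. A j *v z 1 - A j *v z j) = t *\<^sub>R (\<Sum>j=1..m. \<Sum>i\<in>{1..<j}. A j *v g i)"
    by (simp only: scaleR_sum_right[of t, where A = "{1..m}"] diff cong: sum.cong)
  finally have "e = (\<Sum>j=1..m. \<Sum>i\<in>{1..<j}. A j *v g i)" using t by simp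
  also have "\<dots> = (\<Sum>(j, i) \<in> (SIGMA j:{1..m}. {1..<j}). A j *v g i)"
    by (rule sum.Sigma) auto
  also have "\<dots> = (\<Sum>(i, j) \<in> {(i, j). 1 \<le> i \<and> i < j \<and> j \<le> m}. A j *v g i)"
    by (rule sum.reindex_bij_witness[where i = prod.swap and j = prod.swap]) auto
  finally show ?thesis by (simp add: g_def)
qed

text \<open>Each inner step is affine with bounded stepsize, so the distance of an inner iterate to a reference
  point \<open>y\<close>, and with it each gradient, grows at most linearly in the distance at the start of the
  cycle. The constant depends on the position in the cycle but not on the cycle.\<close>

lemma cycle_inner_bound:
  fixes A :: "nat \<Rightarrow> real ^ 'n ^ 'n" and b :: "nat \<Rightarrow> real ^ 'n" and z :: "nat \<Rightarrow> nat \<Rightarrow> real ^ 'n"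
  assumes step: "\<And>k i. k \<ge> 1 \<Longrightarrow> i \<in> {1..m} \<Longrightarrow> z k (i + 1) = z k i - t k *\<^sub>R (A i *v z k i - b i)"
    and t: "\<And>k. k \<ge> 1 \<Longrightarrow> 0 \<le> t k \<and> t k \<le> T"
    and i: "i \<in> {1..m}"
  shows "\<exists>C\<ge>0. \<forall>k\<ge>1. norm (A i *v z k i - b i) \<le> C * (1 + norm (z k 1 - y))"
proof -
  have grad: "norm (A i *v v - b i) \<le> onorm ((*v) (A i)) * norm (v - y) + norm (A i *v y - b i)" for i v
  proof -
    have "A i *v v - b i = A i *v (v - y) + (A i *v y - b i)"
      by (simp add: matrix_vector_mult_diff_distrib)
    also have "norm \<dots> \<le> norm (A i *v (v - y)) + norm (A i *v y - b i)" by (rule norm_triangle_ineq)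
    also have "norm (A i *v (v - y)) \<le> onorm ((*v) (A i)) * norm (v - y)"
      by (intro onorm matrix_vector_mul_bounded_linear)
    finally show ?thesis by simp
  qed
  have on: "onorm ((*v) (A i)) \<ge> 0" for i
    by (intro onorm_pos_le matrix_vector_mul_bounded_linear)
  have gradC: "\<exists>C\<ge>0. \<forall>k\<ge>1. norm (A i *v z k i - b i) \<le> C * (1 + norm (z k 1 - y))"
    if "D \<ge> 0" "\<And>k. k \<ge> 1 \<Longrightarrow> norm (z k i - y) \<le> D * (1 + norm (z k 1 - y))" for i D
  proof (intro exI conjI allI impI)
    let ?C = "onorm ((*v) (A i)) * D + norm (A i *v y - b i)"
    show "0 \<le> ?C" using on that(1) by simp
    fix k :: nat assume k: "k \<ge> 1"
    have "norm (A i *v z k i - b i) \<le> onorm ((*v) (A i)) * norm (z k i - y) + norm (A i *v y - b i)"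
      by (rule grad)
    also have "\<dots> \<le> onorm ((*v) (A i)) * (D * (1 + norm (z k 1 - y)))
        + norm (A i *v y - b i) * (1 + norm (z k 1 - y))"
      using that(2)[OF k] on by (intro add_mono mult_left_mono) (auto simp: mult_le_cancel_left1)
    also have "\<dots> = ?C * (1 + norm (z k 1 - y))" by (simp add: algebra_simps)
    finally show "norm (A i *v z k i - b i) \<le> ?C * (1 + norm (z k 1 - y))" .
  qed
  have "1 \<le> i" "i \<le> m" using i by auto
  then have "\<exists>D\<ge>0. \<forall>k\<ge>1. norm (z k i - y) \<le> D * (1 + norm (z k 1 - y))"
  proof (induction i rule: dec_induct)
    case base
    show ?case by (intro exI[of _ 1]) auto
  next
    case (step i)
    then obtain D where D: "D \<ge> 0" "\<And>k. k \<ge> 1 \<Longrightarrow> norm (z k i - y) \<le> D * (1 + norm (z k 1 - y))"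
      by auto
    obtain C where C: "C \<ge> 0" "\<And>k. k \<ge> 1 \<Longrightarrow> norm (A i *v z k i - b i) \<le> C * (1 + norm (z k 1 - y))"
      using gradC[OF D] by auto
    have T: "T \<ge> 0" using t[of 1] by simp
    show ?case
    proof (intro exI[of _ "D + T * C"] conjI allI impI)
      fix k :: nat assume k: "k \<ge> 1"
      have "z k (Suc i) - y = (z k i - y) - t k *\<^sub>R (A i *v z k i - b i)"
        using assms(1)[OF k, of i] step by simp
      also have "norm \<dots> \<le> norm (z k i - y) + norm (t k *\<^sub>R (A i *v z k i - b i))"
        by (rule norm_triangle_ineq4)
      also have "norm (t k *\<^sub>R (A i *v z k i - b i)) \<le> T * (C * (1 + norm (z k 1 - y)))"
        using t[OF k] C(2)[OF k] T by (simp add: mult_mono)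
      finally show "norm (z k (Suc i) - y) \<le> (D + T * C) * (1 + norm (z k 1 - y))"
        using D(2)[OF k] by (simp add: algebra_simps)
    qed (use D C T in simp)
  qed
  then show ?thesis using gradC by blast
qed

text \<open>With vanishing stepsizes the iterates of one cycle merge in the limit.\<close>

lemma cycle_inner_tendsto:
  fixes A :: "nat \<Rightarrow> real ^ 'n ^ 'n" and b :: "nat \<Rightarrow> real ^ 'n" and z :: "nat \<Rightarrow> nat \<Rightarrow> real ^ 'n"
  assumes step: "\<And>k i. k \<ge> 1 \<Longrightarrow> i \<in> {1..m} \<Longrightarrow> z k (i + 1) = z k i - t k *\<^sub>R (A i *v z k i - b i)"
    and t: "t \<longlonglongrightarrow> 0" and z: "(\<lambda>k. z k 1) \<longlonglongrightarrow> y" and i: "1 \<le> i" "i \<le> m"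
  shows "(\<lambda>k. z k i) \<longlonglongrightarrow> y"
  using i
proof (induction i rule: dec_induct)
  case (step i)
  then have IH: "(\<lambda>k. z k i) \<longlonglongrightarrow> y" by simp
  have "(\<lambda>k. z k i - t k *\<^sub>R (A i *v z k i - b i)) \<longlonglongrightarrow> y - 0 *\<^sub>R (A i *v y - b i)"
    by (intro tendsto_intros IH t bounded_linear.tendsto[OF matrix_vector_mul_bounded_linear])
  then have "(\<lambda>k. z k i - t k *\<^sub>R (A i *v z k i - b i)) \<longlonglongrightarrow> y" by simp
  then show ?case
    by (rule Lim_transform_eventually)
       (use eventually_ge_at_top[of 1] in eventually_elim, use assms(1) step in simp)
qed (rule z)

section \<open>Convergence of the outer iterates\<close>

text \<open>The incremental gradient iteration with the gradients of the component functions spelled out as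
  $A_i z - b_i$, and with strong convexity and optimality of \<open>y\<close> reduced to the linear-algebraic
  properties of $\sum_i A_i$ from which all rates follow.\<close>

locale quadratic_ig =
  fixes m :: nat and A :: "nat \<Rightarrow> real ^ 'n ^ 'n" and b :: "nat \<Rightarrow> real ^ 'n"
    and t :: "nat \<Rightarrow> real" and z :: "nat \<Rightarrow> nat \<Rightarrow> real ^ 'n" and e :: "nat \<Rightarrow> real ^ 'n"
    and c :: real and y :: "real ^ 'n"
  assumes step: "\<And>k i. k \<ge> 1 \<Longrightarrow> i \<in> {1..m} \<Longrightarrow> z k (i + 1) = z k i - t k *\<^sub>R (A i *v z k i - b i)"
    and cycle: "\<And>k. k \<ge> 1 \<Longrightarrow> z (k + 1) 1 = z k (m + 1)"
    and remainder: "\<And>k. k \<ge> 1 \<Longrightarrow> z (k + 1) 1 =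
      (mat 1 - t k *\<^sub>R (\<Sum>i=1..m. A i)) *v z k 1 + t k *\<^sub>R (\<Sum>i=1..m. b i) + (t k)\<^sup>2 *\<^sub>R e k"
    and sym: "transpose (\<Sum>i=1..m. A i) = (\<Sum>i=1..m. A i)"
    and c: "c > 0"
    and form: "\<And>v. c * (norm v)\<^sup>2 \<le> v \<bullet> ((\<Sum>i=1..m. A i) *v v)"
    and y: "(\<Sum>i=1..m. A i) *v y = (\<Sum>i=1..m. b i)"
    and t: "\<And>k. k \<ge> 1 \<Longrightarrow> 0 < t k"
begin

abbreviation total :: "real ^ 'n ^ 'n" where "total \<equiv> \<Sum>i=1..m. A i"
abbreviation dist_opt :: "nat \<Rightarrow> real" where "dist_opt k \<equiv> norm (z k 1 - y)"
abbreviation pairs :: "(nat \<times> nat) set" where "pairs \<equiv> {(i, j). 1 \<le> i \<and> i < j \<and> j \<le> m}"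

lemma distance_recursion:
  assumes k: "k \<ge> 1" and small: "t k * onorm ((*v) total) \<le> 1"
  shows "dist_opt (k + 1) \<le> (1 - c * t k) * dist_opt k + (t k)\<^sup>2 * norm (e k)"
    and "c * t k \<le> 1"
proof -
  note contraction = gradient_step_contraction[OF sym form less_imp_le[OF t[OF k]] small]
  show "c * t k \<le> 1" by (rule contraction)
  have fixpoint: "(mat 1 - t k *\<^sub>R total) *v y + t k *\<^sub>R (\<Sum>i=1..m. b i) = y"
    unfolding y[symmetric]
    by (simp add: matrix_vector_mult_diff_rdistrib scaleR_matrix_vector_assoc)
  have "z (k + 1) 1 - y = (mat 1 - t k *\<^sub>R total) *v (z k 1 - y) + (t k)\<^sup>2 *\<^sub>R e k"
    unfolding matrix_vector_mult_diff_distrib using remainder[OF k] fixpoint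
    by (metis (no_types, lifting) add.commute add_diff_cancel_right add_diff_eq diff_add_eq)
  also have "norm \<dots> \<le> norm ((mat 1 - t k *\<^sub>R total) *v (z k 1 - y)) + norm ((t k)\<^sup>2 *\<^sub>R e k)"
    by (rule norm_triangle_ineq)
  also have "\<dots> \<le> (1 - c * t k) * dist_opt k + (t k)\<^sup>2 * norm (e k)"
    using contraction(1)[of "z k 1 - y"] by simp
  finally show "dist_opt (k + 1) \<le> (1 - c * t k) * dist_opt k + (t k)\<^sup>2 * norm (e k)" .
qed

lemma remainder_formula:
  assumes k: "k \<ge> 1"
  shows "e k = (\<Sum>(i, j) \<in> pairs. A j *v (A i *v z k i - b i))"
proof (rule cycle_remainder_formula)
  show "z k (m + 1) = (mat 1 - t k *\<^sub>R total) *v z k 1 + t k *\<^sub>R (\<Sum>i=1..m. b i) + (t k)\<^sup>2 *\<^sub>R e k"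
    using remainder[OF k] cycle[OF k] by simp
qed (use step t[OF k] k in auto)

lemma finite_pairs: "finite pairs"
  by (rule finite_subset[of _ "{1..m} \<times> {1..m}"]) auto

lemma remainder_bound:
  assumes T: "\<And>k. k \<ge> 1 \<Longrightarrow> t k \<le> T"
  obtains C where "C > 0" "\<And>k. k \<ge> 1 \<Longrightarrow> norm (e k) \<le> C * (1 + dist_opt k)"
proof -
  have "\<forall>i\<in>{1..m}. \<exists>C\<ge>0. \<forall>k\<ge>1. norm (A i *v z k i - b i) \<le> C * (1 + dist_opt k)"
  proof
    fix i assume i: "i \<in> {1..m}"
    show "\<exists>C\<ge>0. \<forall>k\<ge>1. norm (A i *v z k i - b i) \<le> C * (1 + dist_opt k)"
      by (rule cycle_inner_bound[where z = z and A = A and b = b and m = m and t = t and T = T, OF step])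
         (use i t T less_imp_le in auto)
  qed
  then obtain D where D: "\<And>i. i \<in> {1..m} \<Longrightarrow> D i \<ge> 0"
    "\<And>i k. i \<in> {1..m} \<Longrightarrow> k \<ge> 1 \<Longrightarrow> norm (A i *v z k i - b i) \<le> D i * (1 + dist_opt k)"
    by metis
  define C where "C = (\<Sum>(i, j) \<in> pairs. onorm ((*v) (A j)) * D i)"
  have on: "onorm ((*v) (A j)) \<ge> 0" for j
    by (intro onorm_pos_le matrix_vector_mul_bounded_linear)
  have C: "C \<ge> 0" unfolding C_def using D(1) on by (intro sum_nonneg) auto
  have bound: "norm (e k) \<le> C * (1 + dist_opt k)" if k: "k \<ge> 1" for k
  proof -
    have "norm (e k) \<le> (\<Sum>(i, j) \<in> pairs. norm (A j *v (A i *v z k i - b i)))"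
      unfolding remainder_formula[OF k] split_def by (rule norm_sum)
    also have "\<dots> \<le> (\<Sum>(i, j) \<in> pairs. onorm ((*v) (A j)) * D i * (1 + dist_opt k))"
    proof (rule sum_mono, clarify)
      fix i j assume ij: "1 \<le> i" "i < j" "j \<le> m"
      have "norm (A j *v (A i *v z k i - b i)) \<le> onorm ((*v) (A j)) * norm (A i *v z k i - b i)"
        by (intro onorm matrix_vector_mul_bounded_linear)
      also have "\<dots> \<le> onorm ((*v) (A j)) * (D i * (1 + dist_opt k))"
        using ij k on by (intro mult_left_mono D(2)) auto
      finally show "norm (A j *v (A i *v z k i - b i)) \<le> onorm ((*v) (A j)) * D i * (1 + dist_opt k)"
        by (simp add: mult.assoc)
    qed
    also have "\<dots> = C * (1 + dist_opt k)" by (simp add: C_def sum_distrib_right split_def)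
    finally show ?thesis .
  qed
  show thesis
  proof
    show "C + 1 > 0" using C by simp
    show "norm (e k) \<le> (C + 1) * (1 + dist_opt k)" if "k \<ge> 1" for k
      using bound[OF that] by (simp add: distrib_right add_increasing2)
  qed
qed

lemma remainder_tendsto:
  assumes "t \<longlonglongrightarrow> 0" "(\<lambda>k. z k 1) \<longlonglongrightarrow> y"
  shows "e \<longlonglongrightarrow> (\<Sum>(i, j) \<in> pairs. A j *v (A i *v y - b i))"
proof -
  have "(\<lambda>k. \<Sum>(i, j) \<in> pairs. A j *v (A i *v z k i - b i)) \<longlonglongrightarrow>
      (\<Sum>(i, j) \<in> pairs. A j *v (A i *v y - b i))"
    unfolding split_def
    by (intro tendsto_sum tendsto_intros bounded_linear.tendsto[OF matrix_vector_mul_bounded_linear]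
        cycle_inner_tendsto[where z = z and A = A and b = b and m = m and t = t, OF step assms]) auto
  then show ?thesis
    by (rule Lim_transform_eventually)
       (use eventually_ge_at_top[of 1] in eventually_elim, simp add: remainder_formula)
qed

context
  fixes R s :: real
  assumes R: "R > 0" and s: "0 < s" "s \<le> 1"
    and t_eq: "\<And>k. k \<ge> 1 \<Longrightarrow> t k = R / real k powr s"
begin

lemma stepsize_tendsto: "t \<longlonglongrightarrow> 0"
proof -
  have "(\<lambda>k. R / real k powr s) \<longlonglongrightarrow> 0" using R s by real_asymp
  then show ?thesis
    by (rule Lim_transform_eventually)
       (use eventually_ge_at_top[of 1] in eventually_elim, simp add: t_eq)
qed

lemma eventually_distance_recursion:
  "eventually (\<lambda>k. dist_opt (Suc k) \<le>
     (1 - c * R / real k powr s) * dist_opt k + R\<^sup>2 * norm (e k) / (real k powr s)\<^sup>2) sequentially"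
proof -
  have "(\<lambda>k. t k * onorm ((*v) total)) \<longlonglongrightarrow> 0 * onorm ((*v) total)"
    by (intro tendsto_intros stepsize_tendsto)
  then have "eventually (\<lambda>k. t k * onorm ((*v) total) < 1) sequentially"
    by (intro order_tendstoD) auto
  then show ?thesis using eventually_ge_at_top[of 1]
  proof eventually_elim
    case (elim k)
    then show ?case
      using distance_recursion(1)[of k] by (simp add: t_eq power_divide)
  qed
qed

text \<open>The linear growth bound on the remainder turns the recursion into
  $d_{k+1} \le (1 - c\alpha_k + C\alpha_k^2) d_k + C\alpha_k^2$: both error terms are quadratic in the stepsize, so
  the relaxation has limiting ratio $0$.\<close>

lemma outer_iterates_tendsto: "(\<lambda>k. z k 1) \<longlonglongrightarrow> y"
proof -
  have "t k \<le> R" if "k \<ge> 1" for k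
  proof -
    have "1 \<le> real k powr s" using that s by (intro ge_one_powr_ge_zero) auto
    then show ?thesis using R that by (simp add: t_eq field_simps)
  qed
  then obtain C where C: "C > 0" "\<And>k. k \<ge> 1 \<Longrightarrow> norm (e k) \<le> C * (1 + dist_opt k)"
    using remainder_bound by metis
  define w where "w k = R\<^sup>2 * C / (real k powr s)\<^sup>2" for k :: nat
  have w: "(\<lambda>k. w k * real k powr s) \<longlonglongrightarrow> 0"
    unfolding w_def using R s C(1) by real_asymp
  have "eventually (\<lambda>k. dist_opt k < \<epsilon>) sequentially" if "\<epsilon> > 0" for \<epsilon>
  proof (rule relaxation_powr_eventually_less[where u = dist_opt and \<beta> = 0 and L = "c * R" and b = w])
    let ?a = "\<lambda>k. c * R / real k powr s - w k"
    show "eventually (\<lambda>k. dist_opt (Suc k) \<le> (1 - ?a k) * dist_opt k + w k) sequentially"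
      using eventually_distance_recursion eventually_ge_at_top[of 1]
    proof eventually_elim
      case (elim k)
      have "R\<^sup>2 * norm (e k) / (real k powr s)\<^sup>2 \<le> R\<^sup>2 * (C * (1 + dist_opt k)) / (real k powr s)\<^sup>2"
        using C(2) elim(2) by (intro divide_right_mono mult_left_mono) auto
      also have "\<dots> = w k * (1 + dist_opt k)" by (simp add: w_def)
      finally show ?case using elim(1) by (simp add: algebra_simps)
    qed
    have "(\<lambda>k. c * R - w k * real k powr s) \<longlonglongrightarrow> c * R - 0" by (intro tendsto_intros w)
    then have "(\<lambda>k. c * R - w k * real k powr s) \<longlonglongrightarrow> c * R" by simp
    then show "(\<lambda>k. ?a k * real k powr s) \<longlonglongrightarrow> c * R"
      by (rule Lim_transform_eventually)
         (use eventually_gt_at_top[of 0] in eventually_elim, simp add: left_diff_distrib)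
  qed (use s w R c that in auto)
  then show ?thesis by (simp add: tendsto_iff dist_norm)
qed

lemma remainder_norm_tendsto:
  "(\<lambda>k. norm (e k)) \<longlonglongrightarrow> norm (\<Sum>(i, j) \<in> pairs. A j *v (A i *v y - b i))"
  by (rule tendsto_norm[OF remainder_tendsto[OF stepsize_tendsto outer_iterates_tendsto]])

lemma distance_limsup:
  assumes "L = c * R - (if s = 1 then 1 else 0)" "0 < L"
  shows "limsup (\<lambda>k. ereal (real k powr s * dist_opt k)) \<le>
    ereal (R\<^sup>2 * norm (\<Sum>(i, j) \<in> pairs. A j *v (A i *v y - b i)) / L)"
  by (rule chung_limsup[OF s _ eventually_distance_recursion _ assms])
     (rule norm_ge_zero, intro tendsto_mult_left remainder_norm_tendsto)

text \<open>In the slow regimes only the order of the noise matters, so the convergent remainders are replaced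
  by a bound.\<close>

lemma eventually_distance_recursion_const:
  obtains K where "K > 0" "eventually (\<lambda>k. dist_opt (Suc k) \<le>
    (1 - c * R / real k powr s) * dist_opt k + K / (real k powr s)\<^sup>2) sequentially"
proof -
  have "Bseq (\<lambda>k. norm (e k))"
    using remainder_norm_tendsto by (intro convergent_imp_Bseq) (auto simp: convergent_def)
  then obtain D where D: "D > 0" "\<And>k. norm (e k) \<le> D" by (auto simp: Bseq_def)
  show thesis
  proof
    show "R\<^sup>2 * D > 0" using R D by simp
    show "eventually (\<lambda>k. dist_opt (Suc k) \<le>
      (1 - c * R / real k powr s) * dist_opt k + R\<^sup>2 * D / (real k powr s)\<^sup>2) sequentially"
      using eventually_distance_recursion
    proof eventually_elim
      case (elim k)
      have "R\<^sup>2 * norm (e k) / (real k powr s)\<^sup>2 \<le> R\<^sup>2 * D / (real k powr s)\<^sup>2"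
        using D by (intro divide_right_mono mult_left_mono) auto
      with elim show ?case by simp
    qed
  qed
qed

end

text \<open>The number $R B / c$ is the fixed point of $d \mapsto (1 - cR) d + R^2 B$, so the excess over it
  contracts geometrically.\<close>

lemma constant_stepsize_bound:
  assumes R: "R > 0" and t_eq: "\<And>k. k \<ge> 1 \<Longrightarrow> t k = R"
    and small: "R * onorm ((*v) total) \<le> 1" and B: "\<And>k. k \<ge> 1 \<Longrightarrow> norm (e k) \<le> B"
  shows "dist_opt (k + 1) \<le> (1 - c * R) ^ k * dist_opt 1 + R * B / c"
proof (induction k)
  case 0
  have "0 \<le> B" using order_trans[OF norm_ge_zero B[of 1]] by simp
  then show ?case using R c by simp
next
  case (Suc k)
  have rec: "dist_opt (Suc k + 1) \<le> (1 - c * R) * dist_opt (k + 1) + R\<^sup>2 * norm (e (k + 1))"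
    and cR: "c * R \<le> 1"
    using distance_recursion[of "k + 1"] small by (simp_all add: t_eq)
  have "dist_opt (Suc k + 1) \<le> (1 - c * R) * ((1 - c * R) ^ k * dist_opt 1 + R * B / c) + R\<^sup>2 * B"
  proof (rule order_trans[OF rec], rule add_mono)
    show "(1 - c * R) * dist_opt (k + 1) \<le> (1 - c * R) * ((1 - c * R) ^ k * dist_opt 1 + R * B / c)"
      using cR Suc.IH by (intro mult_left_mono) auto
    show "R\<^sup>2 * norm (e (k + 1)) \<le> R\<^sup>2 * B" using B by (intro mult_left_mono) auto
  qed
  also have "\<dots> = (1 - c * R) ^ Suc k * dist_opt 1 + R * B / c"
    using c by (simp add: field_simps power2_eq_square)
  finally show ?case .
qed

end

theorem theorem3p1:
  fixes m :: nat
    and P :: "nat \<Rightarrow> real ^ 'n ^ 'n" and q :: "nat \<Rightarrow> real ^ 'n" and r :: "nat \<Rightarrow> real"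
    and c R s :: real
    and x :: "nat \<Rightarrow> nat \<Rightarrow> real ^ 'n" and E :: "nat \<Rightarrow> real ^ 'n"
    and f :: "nat \<Rightarrow> real ^ 'n \<Rightarrow> real" and F :: "real ^ 'n \<Rightarrow> real"
    and Pt :: "real ^ 'n ^ 'n" and xs :: "real ^ 'n"
    and \<alpha> d :: "nat \<Rightarrow> real" and M :: real
  assumes f: "\<And>i. i \<in> {1..m} \<Longrightarrow> f i = quadratic (P i) (q i) (r i)"
    and sym: "\<And>i. i \<in> {1..m} \<Longrightarrow> transpose (P i) = P i"
    and F: "F = (\<lambda>y. \<Sum>i=1..m. f i y)"
    and sc: "strongly_convex c F"
    and xs: "xs = the_minimizer F"
    and Pt: "Pt = (\<Sum>i=1..m. P i)"
    and R: "R > 0" and s: "s \<in> {0..1}"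
    and \<alpha>: "\<And>k. k \<ge> 1 \<Longrightarrow> \<alpha> k = R / real k powr s"
    and iter: "ig_iterates m f \<alpha> x"
    and E: "ig_remainder Pt (\<Sum>i=1..m. q i) \<alpha> x E"
    and d: "d = (\<lambda>k. norm (x k 1 - xs))"
    and M: "M = norm (\<Sum>(i, j) \<in> {(i, j). 1 \<le> i \<and> i < j \<and> j \<le> m}. P j *v gradient (f i) xs)"
  shows
    "(s = 1 \<longrightarrow>
        (\<lambda>k. norm (E k)) \<longlonglongrightarrow> M \<and>
        (R > 1 / c \<longrightarrow> limsup (\<lambda>k. ereal (real k * d k)) \<le> ereal (R\<^sup>2 * M / (R * c - 1))) \<and>
        (R = 1 / c \<longrightarrow> limsup (\<lambda>k. ereal (real k / ln (real k) * d k)) < \<infinity>) \<and>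
        (R < 1 / c \<longrightarrow> limsup (\<lambda>k. ereal (real k powr (R * c) * d k)) < \<infinity>)) \<and>
     (0 < s \<and> s < 1 \<longrightarrow>
        limsup (\<lambda>k. ereal (real k powr s * d k)) \<le> ereal (R * M / c)) \<and>
     (s = 0 \<and> R \<le> 1 / onorm (\<lambda>v. Pt *v v) \<longrightarrow>
        (\<forall>k\<ge>1. ereal (d (k + 1)) \<le>
           ereal ((1 - c * R) ^ k * d 1) + ereal R * (SUP l\<in>{1..}. ereal (norm (E l))) / ereal c))"
proof -
  have r_sum: "F = quadratic Pt (\<Sum>i=1..m. q i) (\<Sum>i=1..m. r i)"
    using f by (simp add: F Pt fun_eq_iff sum_quadratic[symmetric])
  have symPt: "transpose Pt = Pt"
    using sym by (simp add: Pt vec_eq_iff transpose_def)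
  have grad: "gradient (f i) v = P i *v v - q i" if "i \<in> {1..m}" for i v
    using f[OF that] gradient_quadratic[OF sym[OF that]] by simp
  have c: "c > 0" using sc by (simp add: strongly_convex_def)
  interpret quadratic_ig m P q \<alpha> x E c xs
  proof
    show "x k (i + 1) = x k i - \<alpha> k *\<^sub>R (P i *v x k i - q i)" if "k \<ge> 1" "i \<in> {1..m}" for k i
      using iter that grad[OF that(2)] by (simp add: ig_iterates_def)
    show "x (k + 1) 1 = x k (m + 1)" if "k \<ge> 1" for k
      using iter that by (simp add: ig_iterates_def)
    show "x (k + 1) 1 = (mat 1 - \<alpha> k *\<^sub>R (\<Sum>i=1..m. P i)) *v x k 1 + \<alpha> k *\<^sub>R (\<Sum>i=1..m. q i)
        + (\<alpha> k)\<^sup>2 *\<^sub>R E k" if "k \<ge> 1" for k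
      using E that by (simp add: ig_remainder_def Pt)
    show "transpose (\<Sum>i=1..m. P i) = (\<Sum>i=1..m. P i)" using symPt by (simp add: Pt)
    show "c * (norm v)\<^sup>2 \<le> v \<bullet> ((\<Sum>i=1..m. P i) *v v)" for v
      using strongly_convex_quadratic_form sc r_sum Pt by metis
    show "(\<Sum>i=1..m. P i) *v xs = (\<Sum>i=1..m. q i)"
      using quadratic_minimizer_solves symPt sc r_sum Pt xs by metis
  qed (use c \<alpha> R in auto)
  have d_eq: "d k = dist_opt k" for k by (simp add: d)
  have M_eq: "M = norm (\<Sum>(i, j) \<in> pairs. P j *v (P i *v xs - q i))"
    unfolding M by (intro arg_cong[where f = norm] sum.cong) (auto simp: grad)
  have case_one: "(\<lambda>k. norm (E k)) \<longlonglongrightarrow> M \<and>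
      (R > 1 / c \<longrightarrow> limsup (\<lambda>k. ereal (real k * d k)) \<le> ereal (R\<^sup>2 * M / (R * c - 1))) \<and>
      (R = 1 / c \<longrightarrow> limsup (\<lambda>k. ereal (real k / ln (real k) * d k)) < \<infinity>) \<and>
      (R < 1 / c \<longrightarrow> limsup (\<lambda>k. ereal (real k powr (R * c) * d k)) < \<infinity>)" if "s = 1"
  proof (intro conjI impI)
    have s': "0 < s" "s \<le> 1" using that by auto
    show "(\<lambda>k. norm (E k)) \<longlonglongrightarrow> M"
      unfolding M_eq by (rule remainder_norm_tendsto[OF R s' \<alpha>])
    obtain K where K0: "K > 0" and "eventually (\<lambda>k. dist_opt (Suc k) \<le>
        (1 - c * R / real k powr s) * dist_opt k + K / (real k powr s)\<^sup>2) sequentially"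
      by (rule eventually_distance_recursion_const[OF R s' \<alpha>])
    then have K: "K > 0" "eventually (\<lambda>k. dist_opt (Suc k) \<le>
        (1 - c * R / real k) * dist_opt k + K / (real k)\<^sup>2) sequentially"
      using \<open>s = 1\<close> by simp_all
    show "limsup (\<lambda>k. ereal (real k * d k)) \<le> ereal (R\<^sup>2 * M / (R * c - 1))" if "R > 1 / c"
    proof -
      have "0 < R * c - 1" using that c by (simp add: field_simps)
      then show ?thesis
        using distance_limsup[OF R s' \<alpha>, of "R * c - 1"] \<open>s = 1\<close>
        by (simp add: d_eq M_eq mult.commute)
    qed
    show "limsup (\<lambda>k. ereal (real k / ln (real k) * d k)) < \<infinity>" if "R = 1 / c"
    proof -
      have "c * R = 1" using that c by simp
      then show ?thesis unfolding d_eq using K by (intro harmonic_recursion_critical) auto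
    qed
    show "limsup (\<lambda>k. ereal (real k powr (R * c) * d k)) < \<infinity>" if "R < 1 / c"
    proof -
      have "0 < R * c" "R * c < 1" using that c R by (auto simp: field_simps)
      then show ?thesis unfolding d_eq using K
        by (intro harmonic_recursion_subcritical[of K]) (auto simp: mult.commute)
    qed
  qed
  have case_between: "limsup (\<lambda>k. ereal (real k powr s * d k)) \<le> ereal (R * M / c)"
    if "0 < s" "s < 1"
    using distance_limsup[OF R that(1) less_imp_le[OF that(2)] \<alpha>, of "c * R"] that R c
    by (simp add: d_eq M_eq power2_eq_square)
  have case_zero: "ereal (d (k + 1)) \<le>
      ereal ((1 - c * R) ^ k * d 1) + ereal R * (SUP l\<in>{1..}. ereal (norm (E l))) / ereal c"
    if "s = 0" "R \<le> 1 / onorm (\<lambda>v. Pt *v v)" for k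
  proof -
    let ?S = "SUP l\<in>{1..}. ereal (norm (E l))"
    have ge: "ereal (norm (E l)) \<le> ?S" if "l \<ge> 1" for l
      using that by (intro SUP_upper) auto
    show ?thesis
    proof (cases ?S)
      case (real B)
      have "norm (E l) \<le> B" if "l \<ge> 1" for l using ge[OF that] real by simp
      moreover have "\<alpha> l = R" if "l \<ge> 1" for l using \<alpha>[OF that] that \<open>s = 0\<close> by simp
      moreover have "R * onorm ((*v) total) \<le> 1"
      proof -
        have "onorm ((*v) Pt) \<ge> 0" by (intro onorm_pos_le matrix_vector_mul_bounded_linear)
        then have "R * onorm ((*v) Pt) \<le> 1 / onorm ((*v) Pt) * onorm ((*v) Pt)"
          using that(2) by (intro mult_right_mono)
        \<comment> \<open>This also covers a vanishing norm, where the quotient is $0$.\<close>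
        also have "\<dots> \<le> 1" by simp
        finally show ?thesis by (simp add: Pt)
      qed
      ultimately have "dist_opt (k + 1) \<le> (1 - c * R) ^ k * dist_opt 1 + R * B / c"
        by (intro constant_stepsize_bound R)
      then show ?thesis unfolding real d_eq using c by simp
    next
      case PInf
      then show ?thesis using R c by simp
    next
      case MInf
      then show ?thesis using ge[of 1] by simp
    qed
  qed
  show ?thesis using case_one case_between case_zero by blast
qed

end
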